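(* Let $\lambda\in\mathbb R$ and let $\gamma(t)=\Psi(u(t),v(t))$, $t\in[a,b]$, be a smooth non-degenerate curve in $(\mathbb S_1^2)_{xz}^+=\{(x,y,z)\in\mathbb S_1^2:y>0\}$ with $\cosh(u)\sin(v)+\lambda\neq0$ along $\gamma$. Then $\gamma$ is a catenary with respect to the plane $\Pi_{xz}=\{y=0\}$ (with Lagrange multiplier $\lambda$) if and only if its curvature $\kappa$ satisfies $$\kappa=-\frac{u'\cos(v)+v'\sinh(u)\cosh(u)\sin(v)}{(\cosh(u)\sin(v)+\lambda)\,|\gamma'|}.$$
   Context: $\mathbb L^3$ is $\mathbb R^3$ with the metric $\langle\,,\rangle=(dx)^2+(dy)^2-(dz)^2$, and $\mathbb S_1^2=\{(x,y,z):x^2+y^2-z^2=1\}$ with the induced metric, parametrized by $\Psi\colon\mathbb R^2\to\mathbb S_1^2$, $\Psi(u,v)=(\cosh(u)\cos v,\cosh(u)\sin v,\sinh(u))$. A curve $\gamma$ is non-degenerate if it is spacelike ($\langle\gamma',\gamma'\rangle>0$ everywhere; $\epsilon=1$) or timelike ($\langle\gamma',\gamma'\rangle<0$ everywhere; $\epsilon=-1$). For $\gamma(t)=\Psi(u(t),v(t))$ one has $|\gamma'|=\sqrt{\epsilon\langle\gamma',\gamma'\rangle}=\sqrt{\epsilon(v'^2\cosh(u)^2-u'^2)}$. The (geodesic) curvature of $\gamma$ in $\mathbb S_1^2$ is $\kappa=\epsilon\,\dfrac{\langle\gamma'',\gamma'\times\xi(\gamma)\rangle}{|\gamma'|^3}=\epsilon\,\dfrac{\det(\gamma,\gamma',\gamma'')}{|\gamma'|^3}$,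 where $\xi(p)=-p$ and $\times$ is the Lorentzian cross product, $\langle a\times b,c\rangle=\det(a,b,c)$. The distance of a point $(x,y,z)\in(\mathbb S_1^2)_{xz}^+$ to $\Pi_{xz}$ is $y$. A catenary with respect to $\Pi_{xz}$ with Lagrange multiplier $\lambda$ is a critical point, among curves in $(\mathbb S_1^2)_{xz}^+$ with the same endpoints, of $$\mathcal E_{xz}[\gamma]=\int_a^b(\cosh(u)\sin(v)+\lambda)\sqrt{\epsilon(v'^2\cosh(u)^2-u'^2)}\,dt,$$ i.e. a solution of its Euler-Lagrange equations. *)

theory Defs
  imports "HOL-Analysis.Analysis"
begin

definition linner :: "real^3 \<Rightarrow> real^3 \<Rightarrow> real" where
  "linner p q = p$1 * q$1 + p$2 * q$2 - p$3 * q$3"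

text \<open>The Lorentzian cross product is the Euclidean one with the third coordinate negated;
  \<open>linner_lcross\<close> below is its defining property.\<close>

definition lcross :: "real^3 \<Rightarrow> real^3 \<Rightarrow> real^3" where
  "lcross p q = vector [cross3 p q $ 1, cross3 p q $ 2, - (cross3 p q $ 3)]"

lemma linner_lcross: "linner (lcross p q) r = det (vector [p, q, r])"
  by (simp add: linner_def lcross_def cross3_def det_3 algebra_simps)

definition de_Sitter :: "(real^3) set" where
  "de_Sitter = {p. linner p p = 1}"

definition de_Sitter_xz_pos :: "(real^3) set" where
  "de_Sitter_xz_pos = {p \<in> de_Sitter. p$2 > 0}"

definition normal_field :: "real^3 \<Rightarrow> real^3" where
  "normal_field p = - p"

definition Psi :: "real \<Rightarrow> real \<Rightarrow> real^3" where
  "Psi x y = vector [cosh x * cos y, cosh x * sin y, sinh x]"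

lemma Psi_in_de_Sitter: "Psi x y \<in> de_Sitter"
proof -
  have "(cosh x * cos y)\<^sup>2 + (cosh x * sin y)\<^sup>2 = (cosh x)\<^sup>2"
    by (simp add: power_mult_distrib flip: distrib_left)
  then show ?thesis
    using hyperbolic_pythagoras[of x]
    by (simp add: de_Sitter_def linner_def Psi_def power2_eq_square)
qed

definition Psi_curve :: "(real \<Rightarrow> real) \<Rightarrow> (real \<Rightarrow> real) \<Rightarrow> real \<Rightarrow> real^3" where
  "Psi_curve u v t = Psi (u t) (v t)"

text \<open>Curves are defined on a compact interval; derivatives at its endpoints are one-sided.\<close>

definition ivl_deriv ::
    "real \<Rightarrow> real \<Rightarrow> (real \<Rightarrow> 'a::real_normed_vector) \<Rightarrow> real \<Rightarrow> 'a" where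
  "ivl_deriv a b f t = vector_derivative f (at t within {a..b})"

text \<open>\<open>D n\<close> is the \<open>n\<close>-th derivative.\<close>

definition smooth_ivl :: "real \<Rightarrow> real \<Rightarrow> (real \<Rightarrow> 'a::real_normed_vector) \<Rightarrow> bool" where
  "smooth_ivl a b f \<longleftrightarrow>
     (\<exists>D. D 0 = f \<and>
        (\<forall>n. \<forall>t\<in>{a..b}. (D n has_vector_derivative D (Suc n) t) (at t within {a..b})))"

definition spacelike_curve :: "real \<Rightarrow> real \<Rightarrow> (real \<Rightarrow> real^3) \<Rightarrow> bool" where
  "spacelike_curve a b \<gamma> \<longleftrightarrow>
     (\<forall>t\<in>{a..b}. linner (ivl_deriv a b \<gamma> t) (ivl_deriv a b \<gamma> t) > 0)"

definition timelike_curve :: "real \<Rightarrow> real \<Rightarrow> (real \<Rightarrow> real^3) \<Rightarrow> bool" where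
  "timelike_curve a b \<gamma> \<longleftrightarrow>
     (\<forall>t\<in>{a..b}. linner (ivl_deriv a b \<gamma> t) (ivl_deriv a b \<gamma> t) < 0)"

text \<open>A non-degenerate curve together with its causal sign \<open>\<epsilon>\<close>.\<close>

definition nondegenerate :: "real \<Rightarrow> real \<Rightarrow> real \<Rightarrow> (real \<Rightarrow> real^3) \<Rightarrow> bool" where
  "nondegenerate \<epsilon> a b \<gamma> \<longleftrightarrow>
     (\<epsilon> = 1 \<and> spacelike_curve a b \<gamma>) \<or> (\<epsilon> = -1 \<and> timelike_curve a b \<gamma>)"

definition lspeed :: "real \<Rightarrow> real \<Rightarrow> real \<Rightarrow> (real \<Rightarrow> real^3) \<Rightarrow> real \<Rightarrow> real" where
  "lspeed \<epsilon> a b \<gamma> t = sqrt (\<epsilon> * linner (ivl_deriv a b \<gamma> t) (ivl_deriv a b \<gamma> t))"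

definition geodesic_curvature ::
    "real \<Rightarrow> real \<Rightarrow> real \<Rightarrow> (real \<Rightarrow> real^3) \<Rightarrow> real \<Rightarrow> real" where
  "geodesic_curvature \<epsilon> a b \<gamma> t =
     \<epsilon> * linner (ivl_deriv a b (ivl_deriv a b \<gamma>) t)
                (lcross (ivl_deriv a b \<gamma> t) (normal_field (\<gamma> t)))
       / (lspeed \<epsilon> a b \<gamma> t) ^ 3"

lemma geodesic_curvature_det:
  "geodesic_curvature \<epsilon> a b \<gamma> t =
     \<epsilon> * det (vector [\<gamma> t, ivl_deriv a b \<gamma> t, ivl_deriv a b (ivl_deriv a b \<gamma>) t])
       / (lspeed \<epsilon> a b \<gamma> t) ^ 3"
proof -
  have "linner r (lcross q (- p)) = det (vector [p, q, r])" for p q r :: "real^3"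
    by (simp add: linner_def lcross_def cross3_def det_3 algebra_simps)
  then show ?thesis
    by (simp add: geodesic_curvature_def normal_field_def)
qed

definition energy_xz ::
    "real \<Rightarrow> real \<Rightarrow> real \<Rightarrow> real \<Rightarrow> (real \<Rightarrow> real) \<Rightarrow> (real \<Rightarrow> real) \<Rightarrow> real" where
  "energy_xz \<epsilon> l a b u v =
     integral {a..b} (\<lambda>t. (cosh (u t) * sin (v t) + l) *
       sqrt (\<epsilon> * ((ivl_deriv a b v t)\<^sup>2 * (cosh (u t))\<^sup>2 - (ivl_deriv a b u t)\<^sup>2)))"

definition admissible ::
    "real \<Rightarrow> real \<Rightarrow> real \<Rightarrow> (real \<Rightarrow> real) \<Rightarrow> (real \<Rightarrow> real) \<Rightarrow> bool" where
  "admissible \<epsilon> a b u v \<longleftrightarrow>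
     smooth_ivl a b u \<and> smooth_ivl a b v \<and>
     nondegenerate \<epsilon> a b (Psi_curve u v) \<and> Psi_curve u v ` {a..b} \<subseteq> de_Sitter_xz_pos"

text \<open>Joint \<open>C\<^sup>\<infinity>\<close> smoothness on \<open>(-\<delta>, \<delta>) \<times> [a, b]\<close>: \<open>D i j\<close> is the partial derivative
  of order \<open>i\<close> in \<open>s\<close> and \<open>j\<close> in \<open>t\<close>.  Indexing by orders only is no restriction, since
  mixed partial derivatives of a smooth function commute.\<close>

definition smooth_family :: "real \<Rightarrow> real \<Rightarrow> real \<Rightarrow> (real \<Rightarrow> real \<Rightarrow> real) \<Rightarrow> bool" where
  "smooth_family \<delta> a b F \<longleftrightarrow>
     (\<exists>D. D 0 0 = F \<and>
        (\<forall>i j. continuous_on ({-\<delta><..<\<delta>} \<times> {a..b}) (\<lambda>(s, t). D i j s t) \<and>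
          (\<forall>s\<in>{-\<delta><..<\<delta>}. \<forall>t\<in>{a..b}.
             ((\<lambda>s. D i j s t) has_real_derivative D (Suc i) j s t) (at s) \<and>
             (D i j s has_real_derivative D i (Suc j) s t) (at t within {a..b}))))"

definition variation ::
    "real \<Rightarrow> real \<Rightarrow> real \<Rightarrow> (real \<Rightarrow> real) \<Rightarrow> (real \<Rightarrow> real) \<Rightarrow>
     real \<Rightarrow> (real \<Rightarrow> real \<Rightarrow> real) \<Rightarrow> (real \<Rightarrow> real \<Rightarrow> real) \<Rightarrow> bool" where
  "variation \<epsilon> a b u v \<delta> U V \<longleftrightarrow>
     \<delta> > 0 \<and> smooth_family \<delta> a b U \<and> smooth_family \<delta> a b V \<and>
     (\<forall>t\<in>{a..b}. U 0 t = u t \<and> V 0 t = v t) \<and>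
     (\<forall>s\<in>{-\<delta><..<\<delta>}. admissible \<epsilon> a b (U s) (V s) \<and>
        Psi_curve (U s) (V s) a = Psi_curve u v a \<and>
        Psi_curve (U s) (V s) b = Psi_curve u v b)"

text \<open>Critical points of the energy among admissible curves with the same endpoints.\<close>

definition catenary_xz ::
    "real \<Rightarrow> real \<Rightarrow> real \<Rightarrow> real \<Rightarrow> (real \<Rightarrow> real) \<Rightarrow> (real \<Rightarrow> real) \<Rightarrow> bool" where
  "catenary_xz \<epsilon> l a b u v \<longleftrightarrow>
     admissible \<epsilon> a b u v \<and>
     (\<forall>\<delta> U V. variation \<epsilon> a b u v \<delta> U V \<longrightarrow>
        ((\<lambda>s. energy_xz \<epsilon> l a b (U s) (V s)) has_real_derivative 0) (at 0))"

end

theory Submission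
  imports Defs
begin

text \<open>Write \<open>F = cosh u sin v + \<lambda>\<close>, \<open>w = |\<gamma>'|\<close>, \<open>X = u' cos v + v' sinh u cosh u sin v\<close> and
  \<open>H = F \<kappa> w + X\<close>.  The two Euler--Lagrange expressions of the energy are
  \<open>\<epsilon> cosh u v' H / w\<close> and \<open>-\<epsilon> cosh u u' H / w\<close>, so along a variation with field \<open>(\<eta>, \<zeta>)\<close> the
  energy has derivative \<open>\<integral> \<epsilon> cosh u (H / w) (v' \<eta> - u' \<zeta>)\<close>.  If \<open>H = 0\<close> this vanishes.  Conversely,
  no bump functions are needed: with \<open>\<phi> = (t - a) (b - t)\<close>, the field
  \<open>(\<epsilon> \<phi> H w\<^sup>2 v', -\<epsilon> \<phi> H w\<^sup>2 u')\<close> is smooth, vanishes at the endpoints, and turns the integrand into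
  \<open>\<phi> cosh u H\<^sup>2 w (u'\<^sup>2 + v'\<^sup>2) \<ge> 0\<close>, so that criticality forces \<open>H = 0\<close>.\<close>

section \<open>Smooth functions on a compact interval\<close>

text \<open>Since the interval is nondegenerate, derivatives within it are unique even at its
  endpoints, so the choice hidden in \<open>vector_derivative\<close> is pinned down by any known
  derivative.\<close>

lemma ivl_deriv_eqI:
  assumes "a < b" and "t \<in> {a..b}" and "(f has_vector_derivative f') (at t within {a..b})"
  shows "ivl_deriv a b f t = f'"
  using vector_derivative_within_cbox[of a b t f f'] assms by (simp add: ivl_deriv_def)

lemma smooth_ivl_has_vector_derivative:
  assumes "a < b" and "smooth_ivl a b f" and "t \<in> {a..b}"
  shows "(f has_vector_derivative ivl_deriv a b f t) (at t within {a..b})"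
  using assms ivl_deriv_eqI unfolding smooth_ivl_def by metis

lemma smooth_ivl_has_real_derivative:
  fixes f :: "real \<Rightarrow> real"
  assumes "a < b" and "smooth_ivl a b f" and "t \<in> {a..b}"
  shows "(f has_real_derivative ivl_deriv a b f t) (at t within {a..b})"
  using smooth_ivl_has_vector_derivative[OF assms]
  by (simp add: has_real_derivative_iff_has_vector_derivative)

text \<open>Choosing one derivative in the class for every member of the class and iterating this
  choice from \<open>f\<close> produces the whole tower of derivatives.\<close>

lemma smooth_ivl_coinduct:
  assumes "P f"
    and step: "\<And>g. P g \<Longrightarrow>
      \<exists>g'. P g' \<and> (\<forall>t\<in>{a..b}. (g has_vector_derivative g' t) (at t within {a..b}))"
  shows "smooth_ivl a b f"
proof -
  obtain d where d: "\<And>g. P g \<Longrightarrow> P (d g) \<and>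
      (\<forall>t\<in>{a..b}. (g has_vector_derivative d g t) (at t within {a..b}))"
    using step by metis
  have "P ((d ^^ n) f)" for n
    by (induction n) (auto simp: d \<open>P f\<close>)
  then show ?thesis
    unfolding smooth_ivl_def by (intro exI[of _ "\<lambda>n. (d ^^ n) f"]) (auto simp: d)
qed

lemma smooth_ivl_ivl_deriv:
  assumes "a < b" and "smooth_ivl a b f"
  shows "smooth_ivl a b (ivl_deriv a b f)"
proof -
  obtain D where D: "D 0 = f"
      "\<And>n t. t \<in> {a..b} \<Longrightarrow> (D n has_vector_derivative D (Suc n) t) (at t within {a..b})"
    using assms(2) unfolding smooth_ivl_def by metis
  have eq: "ivl_deriv a b f t = D 1 t" if "t \<in> {a..b}" for t
    using ivl_deriv_eqI[OF assms(1) that] D(2)[OF that, of 0] D(1) by simp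
  \<comment> \<open>The tower of \<open>f\<close> is shifted by one, but its entry of order 0 must
    be \<open>ivl_deriv a b f\<close> as a function, whereas \<open>D 1\<close> agrees with it only
    on the interval. Hence that entry alone is replaced, and only the case 0 needs a
    transfer.\<close>
  have "(case_nat (ivl_deriv a b f) (\<lambda>m. D (m + 2)) n has_vector_derivative D (n + 2) t)
      (at t within {a..b})" if "t \<in> {a..b}" for n t
  proof (cases n)
    case 0
    then show ?thesis
      using has_vector_derivative_transform[OF that eq D(2)[OF that, of 1]]
      by (simp add: numeral_2_eq_2)
  next
    case (Suc m)
    then show ?thesis using D(2)[OF that, of "m + 2"] by simp
  qed
  then show ?thesis
    unfolding smooth_ivl_def
    by (intro exI[of _ "case_nat (ivl_deriv a b f) (\<lambda>m. D (m + 2))"]) simp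
qed

text \<open>The derivative of each expression built from smooth functions is again such an expression,
  so coinduction gives all closure properties at once.\<close>

inductive smooth_expr :: "real \<Rightarrow> real \<Rightarrow> (real \<Rightarrow> real) \<Rightarrow> bool" for a b where
  base: "smooth_ivl a b f \<Longrightarrow> smooth_expr a b f"
| const: "smooth_expr a b (\<lambda>t. c)"
| ident: "smooth_expr a b (\<lambda>t. t)"
| add: "smooth_expr a b f \<Longrightarrow> smooth_expr a b g \<Longrightarrow> smooth_expr a b (\<lambda>t. f t + g t)"
| mult: "smooth_expr a b f \<Longrightarrow> smooth_expr a b g \<Longrightarrow> smooth_expr a b (\<lambda>t. f t * g t)"
| sin: "smooth_expr a b f \<Longrightarrow> smooth_expr a b (\<lambda>t. sin (f t))"
| cos: "smooth_expr a b f \<Longrightarrow> smooth_expr a b (\<lambda>t. cos (f t))"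
| sinh: "smooth_expr a b f \<Longrightarrow> smooth_expr a b (\<lambda>t. sinh (f t))"
| cosh: "smooth_expr a b f \<Longrightarrow> smooth_expr a b (\<lambda>t. cosh (f t))"

lemma smooth_expr_derivative:
  assumes "a < b" and "smooth_expr a b f"
  shows "\<exists>f'. smooth_expr a b f' \<and>
    (\<forall>t\<in>{a..b}. (f has_real_derivative f' t) (at t within {a..b}))"
  using assms(2)
proof induction
  case (base f)
  then show ?case
    using smooth_ivl_ivl_deriv[OF assms(1)] smooth_ivl_has_real_derivative[OF assms(1)]
    by (blast intro: smooth_expr.base)
next
  case (const c)
  show ?case by (intro exI[of _ "\<lambda>t. 0"]) (auto intro: smooth_expr.const)
next
  case ident
  show ?case by (intro exI[of _ "\<lambda>t. 1"]) (auto intro!: smooth_expr.const derivative_eq_intros)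
next
  case (add f g)
  then obtain f' g' where "smooth_expr a b f'" "smooth_expr a b g'"
    "\<forall>t\<in>{a..b}. (f has_real_derivative f' t) (at t within {a..b})"
    "\<forall>t\<in>{a..b}. (g has_real_derivative g' t) (at t within {a..b})" by blast
  then show ?case
    by (intro exI[of _ "\<lambda>t. f' t + g' t"])
      (auto intro!: smooth_expr.add derivative_eq_intros)
next
  case (mult f g)
  then obtain f' g' where "smooth_expr a b f'" "smooth_expr a b g'"
    "\<forall>t\<in>{a..b}. (f has_real_derivative f' t) (at t within {a..b})"
    "\<forall>t\<in>{a..b}. (g has_real_derivative g' t) (at t within {a..b})" by blast
  with mult.hyps show ?case
    by (intro exI[of _ "\<lambda>t. f' t * g t + g' t * f t"])
      (auto intro!: smooth_expr.add smooth_expr.mult derivative_eq_intros)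
next
  case (sin f)
  then obtain f' where "smooth_expr a b f'"
    "\<forall>t\<in>{a..b}. (f has_real_derivative f' t) (at t within {a..b})" by blast
  with sin.hyps show ?case
    by (intro exI[of _ "\<lambda>t. cos (f t) * f' t"])
      (auto intro!: smooth_expr.cos smooth_expr.mult derivative_eq_intros)
next
  case (cos f)
  then obtain f' where "smooth_expr a b f'"
    "\<forall>t\<in>{a..b}. (f has_real_derivative f' t) (at t within {a..b})" by blast
  with cos.hyps show ?case
    \<comment> \<open>\<open>smooth_expr\<close> has no rule for negation, so the sign is a constant
      factor.\<close>
    by (intro exI[of _ "\<lambda>t. (-1) * (sin (f t) * f' t)"] conjI smooth_expr.const
        smooth_expr.mult smooth_expr.sin)
      (auto intro!: derivative_eq_intros)
next
  case (sinh f)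
  then obtain f' where "smooth_expr a b f'"
    "\<forall>t\<in>{a..b}. (f has_real_derivative f' t) (at t within {a..b})" by blast
  with sinh.hyps show ?case
    by (intro exI[of _ "\<lambda>t. cosh (f t) * f' t"])
      (auto intro!: smooth_expr.cosh smooth_expr.mult derivative_eq_intros)
next
  case (cosh f)
  then obtain f' where "smooth_expr a b f'"
    "\<forall>t\<in>{a..b}. (f has_real_derivative f' t) (at t within {a..b})" by blast
  with cosh.hyps show ?case
    by (intro exI[of _ "\<lambda>t. sinh (f t) * f' t"])
      (auto intro!: smooth_expr.sinh smooth_expr.mult derivative_eq_intros)
qed

lemma smooth_expr_imp_smooth_ivl:
  assumes "a < b" and "smooth_expr a b f"
  shows "smooth_ivl a b f"
  using assms(2)
proof (rule smooth_ivl_coinduct[where P = "smooth_expr a b"])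
  fix g assume "smooth_expr a b g"
  then show "\<exists>g'. smooth_expr a b g' \<and>
      (\<forall>t\<in>{a..b}. (g has_vector_derivative g' t) (at t within {a..b}))"
    using smooth_expr_derivative[OF assms(1)]
    by (simp add: has_real_derivative_iff_has_vector_derivative)
qed

lemma smooth_ivl_imp_continuous_on:
  fixes f :: "real \<Rightarrow> real"
  assumes "a < b" and "smooth_ivl a b f"
  shows "continuous_on {a..b} f"
  by (rule DERIV_continuous_on) (rule smooth_ivl_has_real_derivative[OF assms])

section \<open>The curve in coordinates\<close>

text \<open>As a linear combination of constant vectors, a triple is differentiated by the sum and
  scaling rules.\<close>

lemma vector_3_axis: "vector [x, y, z] = x *\<^sub>R axis 1 1 + y *\<^sub>R axis 2 1 + z *\<^sub>R (axis 3 1 :: real^3)"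
  by (simp add: vec_eq_iff forall_3 axis_def)

lemma has_vector_derivative_vector_3:
  assumes "(x has_real_derivative x') (at t within S)"
    and "(y has_real_derivative y') (at t within S)"
    and "(z has_real_derivative z') (at t within S)"
  shows "((\<lambda>s. vector [x s, y s, z s] :: real^3) has_vector_derivative vector [x', y', z'])
    (at t within S)"
  unfolding vector_3_axis using assms by (auto intro!: derivative_eq_intros)

text \<open>The first derivatives are arbitrary witnesses \<open>u1\<close>, \<open>v1\<close>, so
  that the formulas apply both to \<open>ivl_deriv\<close> and to the partial derivatives of a
  variation.\<close>

context
  fixes a b :: real and u v u1 v1 :: "real \<Rightarrow> real"
  assumes ab: "a < b"
    and du: "\<And>t. t \<in> {a..b} \<Longrightarrow> (u has_real_derivative u1 t) (at t within {a..b})"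
    and dv: "\<And>t. t \<in> {a..b} \<Longrightarrow> (v has_real_derivative v1 t) (at t within {a..b})"
begin

lemma ivl_deriv_Psi_curve:
  assumes "t \<in> {a..b}"
  shows "ivl_deriv a b (Psi_curve u v) t =
    vector [sinh (u t) * u1 t * cos (v t) - cosh (u t) * (sin (v t) * v1 t),
            sinh (u t) * u1 t * sin (v t) + cosh (u t) * (cos (v t) * v1 t),
            cosh (u t) * u1 t]"
proof -
  have "((\<lambda>s. Psi (u s) (v s)) has_vector_derivative vector
      [sinh (u t) * u1 t * cos (v t) - cosh (u t) * (sin (v t) * v1 t),
       sinh (u t) * u1 t * sin (v t) + cosh (u t) * (cos (v t) * v1 t),
       cosh (u t) * u1 t]) (at t within {a..b})"
    unfolding Psi_def using du[OF assms] dv[OF assms]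
    by (intro has_vector_derivative_vector_3) (auto intro!: derivative_eq_intros)
  then show ?thesis
    unfolding Psi_curve_def[abs_def] by (rule ivl_deriv_eqI[OF ab assms])
qed

lemma linner_ivl_deriv_Psi_curve:
  assumes "t \<in> {a..b}"
  shows "linner (ivl_deriv a b (Psi_curve u v) t) (ivl_deriv a b (Psi_curve u v) t) =
    (v1 t)\<^sup>2 * (cosh (u t))\<^sup>2 - (u1 t)\<^sup>2"
proof -
  have "(sin (v t))\<^sup>2 + (cos (v t))\<^sup>2 = 1" "(cosh (u t))\<^sup>2 = (sinh (u t))\<^sup>2 + 1"
    by (simp_all add: cosh_square_eq)
  then show ?thesis
    unfolding ivl_deriv_Psi_curve[OF assms] linner_def vector_3 by algebra
qed

lemma lspeed_Psi_curve:
  assumes "t \<in> {a..b}"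
  shows "lspeed \<epsilon> a b (Psi_curve u v) t =
    sqrt (\<epsilon> * ((v1 t)\<^sup>2 * (cosh (u t))\<^sup>2 - (u1 t)\<^sup>2))"
  by (simp add: lspeed_def linner_ivl_deriv_Psi_curve[OF assms])

lemma ivl_deriv2_Psi_curve:
  assumes "t \<in> {a..b}"
    and "(u1 has_real_derivative u2) (at t within {a..b})"
    and "(v1 has_real_derivative v2) (at t within {a..b})"
  shows "ivl_deriv a b (ivl_deriv a b (Psi_curve u v)) t =
    vector [(cosh (u t) * (u1 t)\<^sup>2 + sinh (u t) * u2) * cos (v t)
              - 2 * sinh (u t) * u1 t * sin (v t) * v1 t
              - cosh (u t) * (cos (v t) * (v1 t)\<^sup>2 + sin (v t) * v2),
            (cosh (u t) * (u1 t)\<^sup>2 + sinh (u t) * u2) * sin (v t)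
              + 2 * sinh (u t) * u1 t * cos (v t) * v1 t
              + cosh (u t) * (cos (v t) * v2 - sin (v t) * (v1 t)\<^sup>2),
            sinh (u t) * (u1 t)\<^sup>2 + cosh (u t) * u2]"
  (is "_ = ?r")
proof -
  have "((\<lambda>t. vector [sinh (u t) * u1 t * cos (v t) - cosh (u t) * (sin (v t) * v1 t),
            sinh (u t) * u1 t * sin (v t) + cosh (u t) * (cos (v t) * v1 t),
            cosh (u t) * u1 t] :: real^3) has_vector_derivative ?r) (at t within {a..b})"
    using du[OF assms(1)] dv[OF assms(1)] assms(2,3)
    by (intro has_vector_derivative_vector_3)
      (auto intro!: derivative_eq_intros simp: algebra_simps power2_eq_square)
  \<comment> \<open>The coordinate formula for the first derivative is known only on the interval,
    which is enough for a derivative within it.\<close>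
  then have "(ivl_deriv a b (Psi_curve u v) has_vector_derivative ?r) (at t within {a..b})"
    by (rule has_vector_derivative_transform[rotated 2]) (use assms(1) ivl_deriv_Psi_curve in auto)
  then show ?thesis by (rule ivl_deriv_eqI[OF ab assms(1)])
qed

text \<open>The determinant is invariant under rotations about the z-axis, which explains why
  \<open>v\<close> itself disappears; the two Pythagorean identities carry out this
  cancellation.\<close>

lemma geodesic_curvature_Psi_curve:
  assumes "t \<in> {a..b}"
    and "(u1 has_real_derivative u2) (at t within {a..b})"
    and "(v1 has_real_derivative v2) (at t within {a..b})"
  shows "geodesic_curvature \<epsilon> a b (Psi_curve u v) t =
    \<epsilon> * (v1 t * (u2 + (v1 t)\<^sup>2 * cosh (u t) * sinh (u t)) * cosh (u t)
       - u1 t * (v2 * cosh (u t) + 2 * u1 t * v1 t * sinh (u t)))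
    / (lspeed \<epsilon> a b (Psi_curve u v) t) ^ 3"
proof -
  have *: "(sin (v t))\<^sup>2 + (cos (v t))\<^sup>2 = 1" "(cosh (u t))\<^sup>2 = (sinh (u t))\<^sup>2 + 1"
    by (simp_all add: cosh_square_eq)
  have "det (vector [Psi_curve u v t, ivl_deriv a b (Psi_curve u v) t,
          ivl_deriv a b (ivl_deriv a b (Psi_curve u v)) t]) =
      v1 t * (u2 + (v1 t)\<^sup>2 * cosh (u t) * sinh (u t)) * cosh (u t)
       - u1 t * (v2 * cosh (u t) + 2 * u1 t * v1 t * sinh (u t))"
    unfolding ivl_deriv_Psi_curve[OF assms(1)] ivl_deriv2_Psi_curve[OF assms] det_3
      Psi_curve_def Psi_def vector_3
    using * by algebra
  then show ?thesis by (simp add: geodesic_curvature_det)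
qed

end

section \<open>The first variation of the energy\<close>

text \<open>The geometric equation amounts to the vanishing of this quantity; both Euler--Lagrange
  expressions are multiples of it.\<close>

definition curvature_defect ::
    "real \<Rightarrow> real \<Rightarrow> real \<Rightarrow> real \<Rightarrow> (real \<Rightarrow> real) \<Rightarrow> (real \<Rightarrow> real) \<Rightarrow> real \<Rightarrow> real" where
  "curvature_defect \<epsilon> l a b u v t =
     (cosh (u t) * sin (v t) + l) * geodesic_curvature \<epsilon> a b (Psi_curve u v) t
        * lspeed \<epsilon> a b (Psi_curve u v) t
     + (ivl_deriv a b u t * cos (v t) + ivl_deriv a b v t * sinh (u t) * cosh (u t) * sin (v t))"

text \<open>Pointwise integration by parts.  Here \<open>w\<close> is the speed, \<open>(p, q)\<close> and \<open>(p2, q2)\<close> are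
  the first and second derivatives of \<open>(u, v)\<close>, and \<open>(y, z)\<close> is the variation field with
  derivative \<open>(y1, z1)\<close>; the terms after the first line of the right-hand side form the
  derivative of the boundary term \<open>\<epsilon> * F * (C\<^sup>2 * q * z - p * y) / w\<close>.\<close>

lemma first_variation_identity:
  fixes w \<epsilon> p q :: real
  assumes "w > 0" and "w\<^sup>2 = \<epsilon> * (q\<^sup>2 * C\<^sup>2 - p\<^sup>2)" and "\<epsilon> * \<epsilon> = 1"
    and K: "K = q * (p2 + q\<^sup>2 * C * S) * C - p * (q2 * C + 2 * p * q * S)"
    and F: "F = C * sn + l"
  shows "(S * y * sn + C * cs * z) * w
      + F * (\<epsilon> * (q * z1 * C\<^sup>2 + q\<^sup>2 * C * S * y - p * y1) / w) =
    \<epsilon> * C * (F * (\<epsilon> * K / w ^ 3) * w + (p * cs + q * S * C * sn)) / w * (q * y - p * z)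
    + \<epsilon> * (((S * p * sn + C * cs * q) * (C\<^sup>2 * q * z - p * y)
        + F * (2 * C * S * p * q * z + C\<^sup>2 * q2 * z + C\<^sup>2 * q * z1 - p2 * y - p * y1)) / w
      - F * (C\<^sup>2 * q * z - p * y) * (\<epsilon> * (q * q2 * C\<^sup>2 + q\<^sup>2 * C * S * p - p * p2) / w) / w\<^sup>2)"
  (is "?l = ?r")
proof -
  \<comment> \<open>With the reciprocal as a separate variable subject to \<open>w * r = 1\<close>,
    the claim becomes a polynomial identity modulo this relation and the ones for
    \<open>w\<^sup>2\<close> and \<open>\<epsilon> * \<epsilon>\<close>.\<close>
  define r where "r = 1 / w"
  have r: "x / w = x * r" "x / w\<^sup>2 = x * r\<^sup>2" "x / w ^ 3 = x * r ^ 3" for x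
    by (simp_all add: r_def power_divide)
  have "w * r = 1"
    using assms(1) by (simp add: r_def)
  then have "?l = ?r"
    unfolding r K F using assms(2,3) by algebra
  then show ?thesis .
qed

text \<open>A variation fixes the endpoints as points of space, not their parameters. The three
  coordinates are constant in \<open>s\<close>; differentiating \<open>sinh\<close> forces x' = 0,
  and then y' is annihilated by both the sine and the cosine of the same angle.\<close>

lemma variation_field_at_endpoint:
  assumes "\<delta> > 0" and eq: "\<And>s. s \<in> {-\<delta><..<\<delta>} \<Longrightarrow> Psi (x s) (y s) = Psi x0 y0"
    and dx: "(x has_real_derivative x') (at 0)" and dy: "(y has_real_derivative y') (at 0)"
  shows "x' = 0" and "y' = 0"
proof -
  have zero: "d = 0" if "(f has_real_derivative d) (at 0)" and "\<And>s. s \<in> {-\<delta><..<\<delta>} \<Longrightarrow> f s = c"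
    for f :: "real \<Rightarrow> real" and d c
  proof -
    have "((\<lambda>s. c) has_real_derivative d) (at 0)"
      by (rule has_field_derivative_transform_within_open[OF that(1), of "{-\<delta><..<\<delta>}"])
        (use that(2) \<open>\<delta> > 0\<close> in auto)
    then show ?thesis using DERIV_const DERIV_unique by blast
  qed
  have coords: "sinh (x s) = sinh x0" "cosh (x s) * cos (y s) = cosh x0 * cos y0"
      "cosh (x s) * sin (y s) = cosh x0 * sin y0" if "s \<in> {-\<delta><..<\<delta>}" for s
    using eq[OF that] unfolding Psi_def by (simp_all only: vec_eq_iff forall_3 vector_3)
  have "((\<lambda>s. sinh (x s)) has_real_derivative cosh (x 0) * x') (at 0)"
    using dx by (auto intro!: derivative_eq_intros)
  from zero[OF this coords(1)] show x': "x' = 0" by simp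
  have "((\<lambda>s. cosh (x s) * cos (y s)) has_real_derivative - (cosh (x 0) * (sin (y 0) * y'))) (at 0)"
    using dx dy x' by (auto intro!: derivative_eq_intros)
  from zero[OF this coords(2)] have "sin (y 0) * y' = 0" by simp
  moreover have "((\<lambda>s. cosh (x s) * sin (y s)) has_real_derivative cosh (x 0) * (cos (y 0) * y')) (at 0)"
    using dx dy x' by (auto intro!: derivative_eq_intros)
  from zero[OF this coords(3)] have "cos (y 0) * y' = 0" by simp
  moreover have "(sin (y 0))\<^sup>2 + (cos (y 0))\<^sup>2 = 1" by simp
  ultimately show "y' = 0" by algebra
qed

text \<open>The factor 2 absorbs the 1/2 of the root, since the squared speed is a quadratic form in
  the velocities. The rule serves both the \<open>s\<close>- and the \<open>t\<close>-derivative of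
  the speed.\<close>

lemma has_real_derivative_sqrt:
  fixes f :: "real \<Rightarrow> real"
  assumes "(f has_real_derivative 2 * d) (at x within S)" and "f x > 0"
  shows "((\<lambda>x. sqrt (f x)) has_real_derivative d / sqrt (f x)) (at x within S)"
  using DERIV_chain2[OF DERIV_real_sqrt[OF assms(2)] assms(1)] by (simp add: field_simps)

text \<open>Differentiation under the integral sign gives the integral of \<open>fs 0\<close>.
  Pointwise, \<open>fs 0\<close> is the stated integrand plus the \<open>t\<close>-derivative of a
  boundary term that vanishes at \<open>a\<close> and \<open>b\<close>.\<close>

lemma first_variation:
  assumes ab: "a < b" and "variation \<epsilon> a b u v \<delta> U V"
  shows "((\<lambda>s. energy_xz \<epsilon> l a b (U s) (V s)) has_real_derivative
    integral {a..b} (\<lambda>t. \<epsilon> * cosh (u t) * curvature_defect \<epsilon> l a b u v t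
        / lspeed \<epsilon> a b (Psi_curve u v) t
      * (ivl_deriv a b v t * deriv (\<lambda>s. U s t) 0 - ivl_deriv a b u t * deriv (\<lambda>s. V s t) 0)))
    (at 0)"
proof -
  define I where "I = {-\<delta><..<\<delta>}"
  have \<delta>: "\<delta> > 0" and UV0: "\<And>t. t \<in> {a..b} \<Longrightarrow> U 0 t = u t" "\<And>t. t \<in> {a..b} \<Longrightarrow> V 0 t = v t"
    and adm: "\<And>s. s \<in> I \<Longrightarrow> admissible \<epsilon> a b (U s) (V s)"
    and ends: "\<And>s. s \<in> I \<Longrightarrow> Psi (U s a) (V s a) = Psi (u a) (v a)"
              "\<And>s. s \<in> I \<Longrightarrow> Psi (U s b) (V s b) = Psi (u b) (v b)"
    and fam: "smooth_family \<delta> a b U" "smooth_family \<delta> a b V"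
    using assms(2) unfolding variation_def I_def by (auto simp: Psi_curve_def)
  have I: "0 \<in> I" "open I" "convex I" using \<delta> by (auto simp: I_def)
  obtain DU where DU: "DU 0 0 = U"
    "\<And>i j. continuous_on (I \<times> {a..b}) (\<lambda>(s, t). DU i j s t)"
    "\<And>i j s t. s \<in> I \<Longrightarrow> t \<in> {a..b} \<Longrightarrow> ((\<lambda>s. DU i j s t) has_real_derivative DU (Suc i) j s t) (at s)"
    "\<And>i j s t. s \<in> I \<Longrightarrow> t \<in> {a..b} \<Longrightarrow> (DU i j s has_real_derivative DU i (Suc j) s t) (at t within {a..b})"
    using fam(1) unfolding smooth_family_def I_def[symmetric] by metis
  obtain DV where DV: "DV 0 0 = V"
    "\<And>i j. continuous_on (I \<times> {a..b}) (\<lambda>(s, t). DV i j s t)"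
    "\<And>i j s t. s \<in> I \<Longrightarrow> t \<in> {a..b} \<Longrightarrow> ((\<lambda>s. DV i j s t) has_real_derivative DV (Suc i) j s t) (at s)"
    "\<And>i j s t. s \<in> I \<Longrightarrow> t \<in> {a..b} \<Longrightarrow> (DV i j s has_real_derivative DV i (Suc j) s t) (at t within {a..b})"
    using fam(2) unfolding smooth_family_def I_def[symmetric] by metis
  have Ut: "(U s has_real_derivative DU 0 1 s t) (at t within {a..b})"
   and Vt: "(V s has_real_derivative DV 0 1 s t) (at t within {a..b})"
    if "s \<in> I" "t \<in> {a..b}" for s t
    using DU(4)[OF that, of 0 0] DV(4)[OF that, of 0 0] DU(1) DV(1) by simp_all
  have Us: "((\<lambda>s. U s t) has_real_derivative DU 1 0 s t) (at s)"
   and Vs: "((\<lambda>s. V s t) has_real_derivative DV 1 0 s t) (at s)"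
    if "s \<in> I" "t \<in> {a..b}" for s t
    using DU(3)[OF that, of 0 0] DV(3)[OF that, of 0 0] DU(1) DV(1) by simp_all
  have ivlU: "ivl_deriv a b (U s) t = DU 0 1 s t"
   and ivlV: "ivl_deriv a b (V s) t = DV 0 1 s t" if "s \<in> I" "t \<in> {a..b}" for s t
    using ivl_deriv_eqI[OF ab that(2)] Ut[OF that] Vt[OF that]
    by (simp_all add: has_real_derivative_iff_has_vector_derivative)
  \<comment> \<open>The squared speed of the varied curve; admissibility keeps it positive, so its
    root is differentiable.\<close>
  define Q where "Q = (\<lambda>s t. \<epsilon> * ((DV 0 1 s t)\<^sup>2 * (cosh (U s t))\<^sup>2 - (DU 0 1 s t)\<^sup>2))"
  have \<epsilon>: "\<epsilon> * \<epsilon> = 1"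
    using adm[OF I(1)] by (auto simp: admissible_def nondegenerate_def)
  have Q: "Q s t > 0" if "s \<in> I" "t \<in> {a..b}" for s t
    using adm[OF that(1)] that(2) linner_ivl_deriv_Psi_curve[OF ab Ut[OF that(1)] Vt[OF that(1)] that(2)]
    unfolding Q_def admissible_def nondegenerate_def spacelike_curve_def timelike_curve_def
    by fastforce
  \<comment> \<open>\<open>f\<close> is the integrand of the energy along the family, and
    \<open>fs\<close> is its derivative in the parameter \<open>s\<close>.\<close>
  define f where "f = (\<lambda>s t. (cosh (U s t) * sin (V s t) + l) * sqrt (Q s t))"
  define fs where "fs = (\<lambda>s t.
    (sinh (U s t) * DU 1 0 s t * sin (V s t) + cosh (U s t) * cos (V s t) * DV 1 0 s t) * sqrt (Q s t)
    + (cosh (U s t) * sin (V s t) + l) * (\<epsilon> * (DV 0 1 s t * DV 1 1 s t * (cosh (U s t))\<^sup>2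
        + (DV 0 1 s t)\<^sup>2 * cosh (U s t) * sinh (U s t) * DU 1 0 s t - DU 0 1 s t * DU 1 1 s t)
       / sqrt (Q s t)))"
  have energy: "energy_xz \<epsilon> l a b (U s) (V s) = integral {a..b} (f s)" if "s \<in> I" for s
    unfolding energy_xz_def f_def Q_def using that
    by (intro integral_cong) (simp add: ivlU ivlV)
  have DU11: "((\<lambda>s. DU 0 1 s t) has_real_derivative DU 1 1 s t) (at s)"
   and DV11: "((\<lambda>s. DV 0 1 s t) has_real_derivative DV 1 1 s t) (at s)"
    if "s \<in> I" "t \<in> {a..b}" for s t
    using DU(3)[OF that, of 0 1] DV(3)[OF that, of 0 1] by simp_all
  have dQ: "((\<lambda>s. Q s t) has_real_derivative 2 * (\<epsilon> * (DV 0 1 s t * DV 1 1 s t * (cosh (U s t))\<^sup>2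
        + (DV 0 1 s t)\<^sup>2 * cosh (U s t) * sinh (U s t) * DU 1 0 s t - DU 0 1 s t * DU 1 1 s t))) (at s)"
    if "s \<in> I" "t \<in> {a..b}" for s t
    unfolding Q_def
    by (rule derivative_eq_intros DU11[OF that] DV11[OF that] Us[OF that] Vs[OF that] refl)+
      (simp add: algebra_simps power2_eq_square)
  have df: "((\<lambda>s. f s t) has_real_derivative fs s t) (at s)" if "s \<in> I" "t \<in> {a..b}" for s t
    unfolding f_def fs_def
    by (rule derivative_eq_intros has_real_derivative_sqrt[OF dQ[OF that] Q[OF that]]
        Us[OF that] Vs[OF that] refl)+
      (simp add: algebra_simps)
  have cont: "continuous_on (I \<times> {a..b}) (\<lambda>x. DU i j (fst x) (snd x))"
      "continuous_on (I \<times> {a..b}) (\<lambda>x. DV i j (fst x) (snd x))" for i j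
    using DU(2)[of i j] DV(2)[of i j] by (simp_all add: case_prod_unfold)
  note contUV = cont(1)[of 0 0, unfolded DU(1)] cont(2)[of 0 0, unfolded DV(1)]
  have contQ: "continuous_on (I \<times> {a..b}) (\<lambda>x. Q (fst x) (snd x))"
    unfolding Q_def by (intro continuous_intros cont contUV)
  have contf: "continuous_on (I \<times> {a..b}) (\<lambda>x. f (fst x) (snd x))"
    unfolding f_def by (intro continuous_intros cont contUV contQ)
  have contfs: "continuous_on (I \<times> {a..b}) (\<lambda>x. fs (fst x) (snd x))"
    unfolding fs_def using Q
    by (intro continuous_intros cont contUV contQ ballI) fastforce
  have slice: "continuous_on {a..b} (g s)"
    if "continuous_on (I \<times> {a..b}) (\<lambda>x. g (fst x) (snd x))" "s \<in> I"
    for g :: "real \<Rightarrow> real \<Rightarrow> real" and s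
  proof -
    have "continuous_on {a..b} (\<lambda>t. (s, t))" by (intro continuous_intros)
    from continuous_on_compose2[OF that(1) this] show ?thesis
      using that(2) by (simp add: image_subset_iff)
  qed
  \<comment> \<open>Leibniz rule on the convex parameter interval; as that interval is open, the
    derivative within it at 0 is an ordinary one.\<close>
  have "((\<lambda>s. integral (cbox a b) (f s)) has_vector_derivative integral (cbox a b) (fs 0)) (at 0 within I)"
  proof (rule leibniz_rule_vector_derivative)
    show "((\<lambda>s. f s t) has_vector_derivative fs s t) (at s within I)" if "s \<in> I" "t \<in> cbox a b" for s t
      using df[of s t] that has_vector_derivative_at_within
      by (simp add: has_real_derivative_iff_has_vector_derivative)
    show "f s integrable_on cbox a b" if "s \<in> I" for s
      using slice[OF contf that] by (simp add: integrable_continuous_real)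
    show "continuous_on (I \<times> cbox a b) (\<lambda>(s, t). fs s t)"
      using contfs by (simp add: case_prod_unfold)
  qed (use I in auto)
  then have "((\<lambda>s. integral {a..b} (f s)) has_real_derivative integral {a..b} (fs 0)) (at 0)"
    by (simp only: at_within_open[OF I(1,2)] has_real_derivative_iff_has_vector_derivative
        box_real(2))
  then have leibniz: "((\<lambda>s. energy_xz \<epsilon> l a b (U s) (V s)) has_real_derivative integral {a..b} (fs 0)) (at 0)"
    by (rule has_field_derivative_transform_within_open[OF _ I(2,1)]) (simp add: energy)

  \<comment> \<open>The family restricts to \<open>u\<close> and \<open>v\<close> at
    \<open>s = 0\<close> only for times in the interval, so derivatives are transferred within
    it.\<close>
  have du: "(u has_real_derivative DU 0 1 0 t) (at t within {a..b})"
   and dv: "(v has_real_derivative DV 0 1 0 t) (at t within {a..b})" if "t \<in> {a..b}" for t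
    by (rule has_field_derivative_transform_within[OF Ut[OF I(1) that], of 1];
        use UV0 that in simp)
      (rule has_field_derivative_transform_within[OF Vt[OF I(1) that], of 1];
        use UV0 that in simp)
  have du2: "(DU 0 1 0 has_real_derivative DU 0 2 0 t) (at t within {a..b})"
   and dv2: "(DV 0 1 0 has_real_derivative DV 0 2 0 t) (at t within {a..b})"
   and dy: "(DU 1 0 0 has_real_derivative DU 1 1 0 t) (at t within {a..b})"
   and dz: "(DV 1 0 0 has_real_derivative DV 1 1 0 t) (at t within {a..b})" if "t \<in> {a..b}" for t
    using DU(4)[OF I(1) that, of 0 1] DV(4)[OF I(1) that, of 0 1]
      DU(4)[OF I(1) that, of 1 0] DV(4)[OF I(1) that, of 1 0] by (simp_all add: numeral_2_eq_2)
  define w where "w = (\<lambda>t. sqrt (\<epsilon> * ((DV 0 1 0 t)\<^sup>2 * (cosh (u t))\<^sup>2 - (DU 0 1 0 t)\<^sup>2)))"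
  have Q0: "\<epsilon> * ((DV 0 1 0 t)\<^sup>2 * (cosh (u t))\<^sup>2 - (DU 0 1 0 t)\<^sup>2) > 0" if "t \<in> {a..b}" for t
    using Q[OF I(1) that] UV0[OF that] by (simp add: Q_def)
  have w: "w t > 0" "(w t)\<^sup>2 = \<epsilon> * ((DV 0 1 0 t)\<^sup>2 * (cosh (u t))\<^sup>2 - (DU 0 1 0 t)\<^sup>2)"
    if "t \<in> {a..b}" for t
    using Q0[OF that] unfolding w_def by simp_all
  have dw: "(w has_real_derivative \<epsilon> * (DV 0 1 0 t * DV 0 2 0 t * (cosh (u t))\<^sup>2
        + (DV 0 1 0 t)\<^sup>2 * cosh (u t) * sinh (u t) * DU 0 1 0 t - DU 0 1 0 t * DU 0 2 0 t) / w t)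
      (at t within {a..b})" if "t \<in> {a..b}" for t
    unfolding w_def
  proof (rule has_real_derivative_sqrt)
    show "((\<lambda>t. \<epsilon> * ((DV 0 1 0 t)\<^sup>2 * (cosh (u t))\<^sup>2 - (DU 0 1 0 t)\<^sup>2)) has_real_derivative
      2 * (\<epsilon> * (DV 0 1 0 t * DV 0 2 0 t * (cosh (u t))\<^sup>2
        + (DV 0 1 0 t)\<^sup>2 * cosh (u t) * sinh (u t) * DU 0 1 0 t - DU 0 1 0 t * DU 0 2 0 t)))
      (at t within {a..b})"
      by (rule derivative_eq_intros du[OF that] dv[OF that] du2[OF that] dv2[OF that] refl)+
        (simp add: algebra_simps power2_eq_square)
  qed (rule Q0[OF that])
  \<comment> \<open>The boundary term: the partial derivatives of the Lagrangian with respect to u'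
    and v', paired with the variation field. \<open>B1\<close> is its derivative by the quotient
    rule.\<close>
  define B where "B = (\<lambda>t. \<epsilon> * (cosh (u t) * sin (v t) + l)
      * ((cosh (u t))\<^sup>2 * DV 0 1 0 t * DV 1 0 0 t - DU 0 1 0 t * DU 1 0 0 t) / w t)"
  define B1 where "B1 = (\<lambda>t. \<epsilon> * (((sinh (u t) * DU 0 1 0 t * sin (v t) + cosh (u t) * cos (v t) * DV 0 1 0 t)
          * ((cosh (u t))\<^sup>2 * DV 0 1 0 t * DV 1 0 0 t - DU 0 1 0 t * DU 1 0 0 t)
        + (cosh (u t) * sin (v t) + l)
          * (2 * cosh (u t) * sinh (u t) * DU 0 1 0 t * DV 0 1 0 t * DV 1 0 0 t
            + (cosh (u t))\<^sup>2 * DV 0 2 0 t * DV 1 0 0 t + (cosh (u t))\<^sup>2 * DV 0 1 0 t * DV 1 1 0 t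
            - DU 0 2 0 t * DU 1 0 0 t - DU 0 1 0 t * DU 1 1 0 t)) / w t
      - (cosh (u t) * sin (v t) + l) * ((cosh (u t))\<^sup>2 * DV 0 1 0 t * DV 1 0 0 t - DU 0 1 0 t * DU 1 0 0 t)
        * (\<epsilon> * (DV 0 1 0 t * DV 0 2 0 t * (cosh (u t))\<^sup>2
        + (DV 0 1 0 t)\<^sup>2 * cosh (u t) * sinh (u t) * DU 0 1 0 t - DU 0 1 0 t * DU 0 2 0 t) / w t) / (w t)\<^sup>2))"
  have dB: "(B has_real_derivative B1 t) (at t within {a..b})" if "t \<in> {a..b}" for t
  proof -
    have F: "((\<lambda>t. cosh (u t) * sin (v t) + l) has_real_derivative
        sinh (u t) * DU 0 1 0 t * sin (v t) + cosh (u t) * cos (v t) * DV 0 1 0 t) (at t within {a..b})"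
      by (rule derivative_eq_intros du[OF that] dv[OF that] refl)+ (simp add: algebra_simps)
    have M: "((\<lambda>t. (cosh (u t))\<^sup>2 * DV 0 1 0 t * DV 1 0 0 t - DU 0 1 0 t * DU 1 0 0 t) has_real_derivative
        2 * cosh (u t) * sinh (u t) * DU 0 1 0 t * DV 0 1 0 t * DV 1 0 0 t
            + (cosh (u t))\<^sup>2 * DV 0 2 0 t * DV 1 0 0 t + (cosh (u t))\<^sup>2 * DV 0 1 0 t * DV 1 1 0 t
            - DU 0 2 0 t * DU 1 0 0 t - DU 0 1 0 t * DU 1 1 0 t) (at t within {a..b})"
      by (rule derivative_eq_intros du[OF that] dv[OF that] du2[OF that] dv2[OF that]
          dy[OF that] dz[OF that] refl)+ (simp add: algebra_simps power2_eq_square)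
    have quot: "((\<lambda>t. \<epsilon> * f t * m t / w t) has_real_derivative
        \<epsilon> * ((f' * m t + f t * m') / w t - f t * m t * w' / (w t)\<^sup>2)) (at t within {a..b})"
      if "(f has_real_derivative f') (at t within {a..b})" "(m has_real_derivative m') (at t within {a..b})"
        "(w has_real_derivative w') (at t within {a..b})" "w t \<noteq> 0" for f m f' m' w'
      using that by (auto intro!: derivative_eq_intros simp: field_simps power2_eq_square)
    show ?thesis
      unfolding B_def B1_def using quot[OF F M dw[OF that]] w(1)[OF that] by simp
  qed
  have B_int: "(B1 has_integral B b - B a) {a..b}"
    using ab dB
    by (intro fundamental_theorem_of_calculus)
      (auto simp: has_real_derivative_iff_has_vector_derivative)
  have zero: "DU 1 0 0 t = 0" "DV 1 0 0 t = 0" if "t = a \<or> t = b" for t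
    using variation_field_at_endpoint[OF \<delta>, of "\<lambda>s. U s t" "\<lambda>s. V s t" "u t" "v t", folded I_def,
        OF _ Us[OF I(1)] Vs[OF I(1)]] ends that ab by auto
  have "B a = 0" "B b = 0" using zero[of a] zero[of b] by (simp_all add: B_def)
  with B_int have B_int0: "(B1 has_integral 0) {a..b}" by simp

  have curv: "curvature_defect \<epsilon> l a b u v t =
     (cosh (u t) * sin (v t) + l) * (\<epsilon> * (DV 0 1 0 t * (DU 0 2 0 t + (DV 0 1 0 t)\<^sup>2 * cosh (u t) * sinh (u t)) * cosh (u t)
       - DU 0 1 0 t * (DV 0 2 0 t * cosh (u t) + 2 * DU 0 1 0 t * DV 0 1 0 t * sinh (u t))) / w t ^ 3) * w t
     + (DU 0 1 0 t * cos (v t) + DV 0 1 0 t * sinh (u t) * cosh (u t) * sin (v t))"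
   and speed: "lspeed \<epsilon> a b (Psi_curve u v) t = w t"
   and ivl: "ivl_deriv a b u t = DU 0 1 0 t" "ivl_deriv a b v t = DV 0 1 0 t" if "t \<in> {a..b}" for t
  proof -
    show speed: "lspeed \<epsilon> a b (Psi_curve u v) t = w t"
      using lspeed_Psi_curve[OF ab du dv that] by (simp add: w_def)
    show ivl: "ivl_deriv a b u t = DU 0 1 0 t" "ivl_deriv a b v t = DV 0 1 0 t"
      using ivl_deriv_eqI[OF ab that] du[OF that] dv[OF that]
      by (simp_all add: has_real_derivative_iff_has_vector_derivative)
    have "geodesic_curvature \<epsilon> a b (Psi_curve u v) t =
      \<epsilon> * (DV 0 1 0 t * (DU 0 2 0 t + (DV 0 1 0 t)\<^sup>2 * cosh (u t) * sinh (u t)) * cosh (u t)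
       - DU 0 1 0 t * (DV 0 2 0 t * cosh (u t) + 2 * DU 0 1 0 t * DV 0 1 0 t * sinh (u t))) / w t ^ 3"
      unfolding speed[symmetric]
      by (rule geodesic_curvature_Psi_curve[OF ab du dv that du2[OF that] dv2[OF that]])
    then show "curvature_defect \<epsilon> l a b u v t =
     (cosh (u t) * sin (v t) + l) * (\<epsilon> * (DV 0 1 0 t * (DU 0 2 0 t + (DV 0 1 0 t)\<^sup>2 * cosh (u t) * sinh (u t)) * cosh (u t)
       - DU 0 1 0 t * (DV 0 2 0 t * cosh (u t) + 2 * DU 0 1 0 t * DV 0 1 0 t * sinh (u t))) / w t ^ 3) * w t
     + (DU 0 1 0 t * cos (v t) + DV 0 1 0 t * sinh (u t) * cosh (u t) * sin (v t))"
      by (simp only: curvature_defect_def speed ivl)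
  qed
  define g where "g = (\<lambda>t. \<epsilon> * cosh (u t) * curvature_defect \<epsilon> l a b u v t
        / lspeed \<epsilon> a b (Psi_curve u v) t
      * (ivl_deriv a b v t * deriv (\<lambda>s. U s t) 0 - ivl_deriv a b u t * deriv (\<lambda>s. V s t) 0))"
  \<comment> \<open>Integration by parts in pointwise form; \<open>B1\<close> integrates to 0, so
    \<open>fs 0\<close> and \<open>g\<close> have the same integral.\<close>
  have fs0: "fs 0 t = g t + B1 t" if "t \<in> {a..b}" for t
  proof -
    have "fs 0 t = (sinh (u t) * DU 1 0 0 t * sin (v t) + cosh (u t) * cos (v t) * DV 1 0 0 t) * w t
      + (cosh (u t) * sin (v t) + l) * (\<epsilon> * (DV 0 1 0 t * DV 1 1 0 t * (cosh (u t))\<^sup>2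
        + (DV 0 1 0 t)\<^sup>2 * cosh (u t) * sinh (u t) * DU 1 0 0 t - DU 0 1 0 t * DU 1 1 0 t) / w t)"
      by (simp add: fs_def w_def Q_def UV0[OF that])
    moreover have "g t = \<epsilon> * cosh (u t) * curvature_defect \<epsilon> l a b u v t / w t
        * (DV 0 1 0 t * DU 1 0 0 t - DU 0 1 0 t * DV 1 0 0 t)"
      unfolding g_def speed[OF that] ivl[OF that]
        DERIV_imp_deriv[OF Us[OF I(1) that]] DERIV_imp_deriv[OF Vs[OF I(1) that]] ..
    ultimately show ?thesis
      unfolding B1_def curv[OF that]
      using first_variation_identity[OF w[OF that] \<epsilon> refl refl] by simp
  qed
  have "(fs 0 has_integral integral {a..b} (fs 0)) {a..b}"
    using slice[OF contfs I(1)] by (simp add: integrable_continuous_real integrable_integral)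
  from has_integral_diff[OF this B_int0]
  have "((\<lambda>t. fs 0 t - B1 t) has_integral integral {a..b} (fs 0)) {a..b}" by simp
  then have "(g has_integral integral {a..b} (fs 0)) {a..b}"
    by (rule has_integral_cong[THEN iffD1, rotated]) (simp add: fs0)
  then show ?thesis
    using leibniz unfolding g_def by (simp add: integral_unique)
qed

section \<open>Existence of variations\<close>

text \<open>A tube argument: the points of the compact set \<open>{-1..1} \<times> K\<close> where
  \<open>f\<close> fails to be positive form a compact set, whose projection to the
  \<open>s\<close>-axis is closed and misses 0.\<close>

lemma compact_pos_near_zero:
  fixes f :: "real \<Rightarrow> real \<Rightarrow> real"
  assumes "compact K" and cont: "continuous_on ({-1..1} \<times> K) (\<lambda>x. f (fst x) (snd x))"
    and pos: "\<And>t. t \<in> K \<Longrightarrow> f 0 t > 0"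
  obtains \<delta> where "\<delta> > 0" and "\<And>s t. s \<in> {-\<delta><..<\<delta>} \<Longrightarrow> t \<in> K \<Longrightarrow> f s t > 0"
proof -
  have K: "compact ({-1..1::real} \<times> K)"
    using assms(1) by (intro compact_Times) auto
  define Z where "Z = ({-1..1} \<times> K) \<inter> (\<lambda>x. f (fst x) (snd x)) -` {..0}"
  have "closed Z"
    unfolding Z_def using cont K by (intro continuous_closed_preimage) (auto simp: compact_imp_closed)
  moreover have "({-1..1} \<times> K) \<inter> Z = Z" by (auto simp: Z_def)
  ultimately have "compact Z"
    using compact_Int_closed[OF K, of Z] by simp
  then have "closed (fst ` Z)"
    by (intro compact_imp_closed compact_continuous_image continuous_intros)
  moreover have "0 \<notin> fst ` Z"
    using pos by (fastforce simp: Z_def)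
  ultimately obtain e where e: "e > 0" "ball 0 e \<inter> fst ` Z = {}"
    by (metis ComplI open_Compl openE disjoint_eq_subset_Compl)
  show ?thesis
  proof
    show "min e 1 > 0" using e(1) by simp
    show "f s t > 0" if "s \<in> {-min e 1<..<min e 1}" "t \<in> K" for s t
    proof (rule ccontr)
      assume "\<not> f s t > 0"
      with that have "(s, t) \<in> Z" by (auto simp: Z_def)
      then have "s \<in> fst ` Z" by force
      moreover have "s \<in> ball 0 e" using that(1) by (auto simp: dist_real_def)
      ultimately show False using e(2) by blast
    qed
  qed
qed

lemma continuous_on_snd_comp:
  assumes "continuous_on T f"
  shows "continuous_on (S \<times> T) (\<lambda>x. f (snd x))"
  by (rule continuous_on_compose2[OF assms continuous_on_snd[OF continuous_on_id]]) auto

lemma smooth_family_affine: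
  assumes ab: "a < b" and "smooth_ivl a b f" and "smooth_ivl a b g"
  shows "smooth_family \<delta> a b (\<lambda>s t. f t + s * g t)"
proof -
  obtain D where D: "D 0 = f"
      "\<And>n t. t \<in> {a..b} \<Longrightarrow> (D n has_real_derivative D (Suc n) t) (at t within {a..b})"
    using assms(2) unfolding smooth_ivl_def has_real_derivative_iff_has_vector_derivative by metis
  obtain E where E: "E 0 = g"
      "\<And>n t. t \<in> {a..b} \<Longrightarrow> (E n has_real_derivative E (Suc n) t) (at t within {a..b})"
    using assms(3) unfolding smooth_ivl_def has_real_derivative_iff_has_vector_derivative by metis
  \<comment> \<open>The family is affine in \<open>s\<close>: the first \<open>s\<close>-derivative
    is the tower of \<open>g\<close>, and all higher ones vanish.\<close>
  define H where "H = (\<lambda>(i::nat) j s t. if i = 0 then D j t + s * E j t else if i = 1 then E j t else 0)"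
  have "continuous_on {a..b} (D n)" "continuous_on {a..b} (E n)" for n
    using D(2) E(2) by (blast intro: DERIV_continuous_on)+
  then have c: "continuous_on ({-\<delta><..<\<delta>} \<times> {a..b}) (\<lambda>x. D n (snd x))"
      "continuous_on ({-\<delta><..<\<delta>} \<times> {a..b}) (\<lambda>x. E n (snd x))" for n
    by (simp_all add: continuous_on_snd_comp)
  show ?thesis
    unfolding smooth_family_def
  proof (intro exI[of _ H] conjI allI ballI)
    show "H 0 0 = (\<lambda>s t. f t + s * g t)" by (simp add: H_def D(1) E(1))
    fix i j
    show "continuous_on ({-\<delta><..<\<delta>} \<times> {a..b}) (\<lambda>(s, t). H i j s t)"
      by (cases "i = 0"; cases "i = 1")
        (simp_all add: H_def case_prod_unfold c
          continuous_on_add continuous_on_mult continuous_on_fst continuous_on_id)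
    fix s t assume "t \<in> {a..b}"
    note d = D(2)[OF this, of j] E(2)[OF this, of j]
    show "((\<lambda>s. H i j s t) has_real_derivative H (Suc i) j s t) (at s)"
      unfolding H_def by (cases "i = 0"; cases "i = 1") (auto intro!: derivative_eq_intros)
    have "((\<lambda>t. D j t + s * E j t) has_real_derivative D (Suc j) t + s * E (Suc j) t) (at t within {a..b})"
      using d by (auto intro!: derivative_eq_intros)
    then show "(H i j s has_real_derivative H i (Suc j) s t) (at t within {a..b})"
      using d by (cases "i = 0"; cases "i = 1") (simp_all add: H_def)
  qed
qed

lemma Psi_in_de_Sitter_xz_pos_iff: "Psi x y \<in> de_Sitter_xz_pos \<longleftrightarrow> sin y > 0"
  using Psi_in_de_Sitter[of x y] mult_less_cancel_left_pos[OF cosh_real_pos[of x], of 0 "sin y"]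
  by (simp add: de_Sitter_xz_pos_def Psi_def)

text \<open>Both causal types become one strict inequality, so a single positivity argument shows
  that they persist under small perturbations.\<close>

lemma nondegenerate_Psi_curve_iff:
  assumes ab: "a < b" and "smooth_ivl a b u" and "smooth_ivl a b v"
  shows "nondegenerate \<epsilon> a b (Psi_curve u v) \<longleftrightarrow> (\<epsilon> = 1 \<or> \<epsilon> = -1) \<and>
    (\<forall>t\<in>{a..b}. \<epsilon> * ((ivl_deriv a b v t)\<^sup>2 * (cosh (u t))\<^sup>2 - (ivl_deriv a b u t)\<^sup>2) > 0)"
  using linner_ivl_deriv_Psi_curve[OF ab smooth_ivl_has_real_derivative[OF ab assms(2)]
      smooth_ivl_has_real_derivative[OF ab assms(3)]]
  unfolding nondegenerate_def spacelike_curve_def timelike_curve_def by auto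

text \<open>Nondegeneracy and the half-space condition are strict inequalities on a compact
  interval, hence survive along the straight-line family for small \<open>s\<close>. Fields
  vanishing at the ends keep the endpoints fixed.\<close>

lemma variation_exists:
  assumes ab: "a < b" and adm: "admissible \<epsilon> a b u v"
    and \<eta>: "smooth_ivl a b \<eta>" "\<eta> a = 0" "\<eta> b = 0"
    and \<zeta>: "smooth_ivl a b \<zeta>" "\<zeta> a = 0" "\<zeta> b = 0"
  obtains \<delta> where "variation \<epsilon> a b u v \<delta> (\<lambda>s t. u t + s * \<eta> t) (\<lambda>s t. v t + s * \<zeta> t)"
proof -
  have u: "smooth_ivl a b u" and v: "smooth_ivl a b v"
    and nd: "\<epsilon> = 1 \<or> \<epsilon> = -1"
      "\<And>t. t \<in> {a..b} \<Longrightarrow> \<epsilon> * ((ivl_deriv a b v t)\<^sup>2 * (cosh (u t))\<^sup>2 - (ivl_deriv a b u t)\<^sup>2) > 0"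
    and y: "\<And>t. t \<in> {a..b} \<Longrightarrow> sin (v t) > 0"
    using adm nondegenerate_Psi_curve_iff[OF ab, of u v \<epsilon>]
    by (auto simp: admissible_def Psi_curve_def image_subset_iff Psi_in_de_Sitter_xz_pos_iff)
  have smooth: "smooth_ivl a b (\<lambda>t. u t + s * \<eta> t)" "smooth_ivl a b (\<lambda>t. v t + s * \<zeta> t)" for s
    by (intro smooth_expr_imp_smooth_ivl[OF ab] smooth_expr.add smooth_expr.mult
        smooth_expr.const smooth_expr.base[OF u] smooth_expr.base[OF v]
        smooth_expr.base[OF \<eta>(1)] smooth_expr.base[OF \<zeta>(1)])+
  have deriv: "ivl_deriv a b (\<lambda>t. f t + s * g t) t = ivl_deriv a b f t + s * ivl_deriv a b g t"
    if "smooth_ivl a b f" "smooth_ivl a b g" "t \<in> {a..b}" for f g :: "real \<Rightarrow> real" and s t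
    using smooth_ivl_has_real_derivative[OF ab that(1,3)]
      smooth_ivl_has_real_derivative[OF ab that(2,3)]
    by (intro ivl_deriv_eqI[OF ab that(3)])
      (auto simp: has_real_derivative_iff_has_vector_derivative[symmetric]
        intro!: derivative_eq_intros)
  have cont: "continuous_on ({-1..1} \<times> {a..b}) (\<lambda>x. f (snd x))" if "smooth_ivl a b f"
    for f :: "real \<Rightarrow> real"
    by (rule continuous_on_snd_comp[OF smooth_ivl_imp_continuous_on[OF ab that]])
  note smooths = u v \<eta>(1) \<zeta>(1) smooth_ivl_ivl_deriv[OF ab u] smooth_ivl_ivl_deriv[OF ab v]
    smooth_ivl_ivl_deriv[OF ab \<eta>(1)] smooth_ivl_ivl_deriv[OF ab \<zeta>(1)]
  \<comment> \<open>\<open>\<delta>1\<close> preserves the causal type, and \<open>\<delta>2\<close>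
    below preserves the positivity of y.\<close>
  obtain \<delta>1 where \<delta>1: "\<delta>1 > 0" "\<And>s t. s \<in> {-\<delta>1<..<\<delta>1} \<Longrightarrow> t \<in> {a..b} \<Longrightarrow>
      \<epsilon> * ((ivl_deriv a b v t + s * ivl_deriv a b \<zeta> t)\<^sup>2 * (cosh (u t + s * \<eta> t))\<^sup>2
        - (ivl_deriv a b u t + s * ivl_deriv a b \<eta> t)\<^sup>2) > 0"
    by (rule compact_pos_near_zero[of "{a..b}" "\<lambda>s t. \<epsilon> * ((ivl_deriv a b v t
          + s * ivl_deriv a b \<zeta> t)\<^sup>2 * (cosh (u t + s * \<eta> t))\<^sup>2
        - (ivl_deriv a b u t + s * ivl_deriv a b \<eta> t)\<^sup>2)"])
      (use nd(2) in \<open>auto intro!: continuous_intros cont smooths\<close>)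
  obtain \<delta>2 where \<delta>2: "\<delta>2 > 0" "\<And>s t. s \<in> {-\<delta>2<..<\<delta>2} \<Longrightarrow> t \<in> {a..b} \<Longrightarrow> sin (v t + s * \<zeta> t) > 0"
    by (rule compact_pos_near_zero[of "{a..b}" "\<lambda>s t. sin (v t + s * \<zeta> t)"])
      (use y in \<open>auto intro!: continuous_intros cont smooths\<close>)
  have "admissible \<epsilon> a b (\<lambda>t. u t + s * \<eta> t) (\<lambda>t. v t + s * \<zeta> t)"
    if s: "s \<in> {-min \<delta>1 \<delta>2<..<min \<delta>1 \<delta>2}" for s
    using smooth s nd(1) \<delta>1(2)[of s] \<delta>2(2)[of s]
    by (auto simp: admissible_def nondegenerate_Psi_curve_iff[OF ab] deriv smooths
        Psi_curve_def Psi_in_de_Sitter_xz_pos_iff)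
  then have "variation \<epsilon> a b u v (min \<delta>1 \<delta>2) (\<lambda>s t. u t + s * \<eta> t) (\<lambda>s t. v t + s * \<zeta> t)"
    using \<delta>1(1) \<delta>2(1) \<eta> \<zeta>
    by (auto simp: variation_def Psi_curve_def intro!: smooth_family_affine[OF ab] u v)
  then show ?thesis by (rule that)
qed

section \<open>Catenaries\<close>

theorem theorem3p1:
  fixes l \<epsilon> a b :: real and u v :: "real \<Rightarrow> real"
  assumes "a < b"
    and "smooth_ivl a b u" and "smooth_ivl a b v"
    and "nondegenerate \<epsilon> a b (Psi_curve u v)"
    and "Psi_curve u v ` {a..b} \<subseteq> de_Sitter_xz_pos"
    and "\<And>t. t \<in> {a..b} \<Longrightarrow> cosh (u t) * sin (v t) + l \<noteq> 0"
  shows "catenary_xz \<epsilon> l a b u v \<longleftrightarrow>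
    (\<forall>t\<in>{a..b}. geodesic_curvature \<epsilon> a b (Psi_curve u v) t =
       - ((ivl_deriv a b u t * cos (v t)
            + ivl_deriv a b v t * sinh (u t) * cosh (u t) * sin (v t))
          / ((cosh (u t) * sin (v t) + l) * lspeed \<epsilon> a b (Psi_curve u v) t)))"
proof -
  note ab = assms(1) and u = assms(2) and v = assms(3)
  define u1 where "u1 = ivl_deriv a b u"
  define v1 where "v1 = ivl_deriv a b v"
  define u2 where "u2 = ivl_deriv a b u1"
  define v2 where "v2 = ivl_deriv a b v1"
  define w where "w = lspeed \<epsilon> a b (Psi_curve u v)"
  have smooth: "smooth_ivl a b u1" "smooth_ivl a b v1" "smooth_ivl a b u2" "smooth_ivl a b v2"
    unfolding u2_def v2_def u1_def v1_def by (intro smooth_ivl_ivl_deriv ab u v)+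
  have du: "\<And>t. t \<in> {a..b} \<Longrightarrow> (u has_real_derivative u1 t) (at t within {a..b})"
   and dv: "\<And>t. t \<in> {a..b} \<Longrightarrow> (v has_real_derivative v1 t) (at t within {a..b})"
   and du1: "\<And>t. t \<in> {a..b} \<Longrightarrow> (u1 has_real_derivative u2 t) (at t within {a..b})"
   and dv1: "\<And>t. t \<in> {a..b} \<Longrightarrow> (v1 has_real_derivative v2 t) (at t within {a..b})"
    using smooth_ivl_has_real_derivative[OF ab] u v smooth
    by (auto simp: u1_def v1_def u2_def v2_def)
  have adm: "admissible \<epsilon> a b u v"
    using assms by (simp add: admissible_def)
  have \<epsilon>: "\<epsilon> * \<epsilon> = 1" and Q: "\<And>t. t \<in> {a..b} \<Longrightarrow> \<epsilon> * ((v1 t)\<^sup>2 * (cosh (u t))\<^sup>2 - (u1 t)\<^sup>2) > 0"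
    using assms(4) nondegenerate_Psi_curve_iff[OF ab u v] by (auto simp: u1_def v1_def)
  have w_eq: "w t = sqrt (\<epsilon> * ((v1 t)\<^sup>2 * (cosh (u t))\<^sup>2 - (u1 t)\<^sup>2))" if "t \<in> {a..b}" for t
    unfolding w_def by (rule lspeed_Psi_curve[OF ab du dv that])
  have w: "w t > 0" "(w t)\<^sup>2 = \<epsilon> * ((v1 t)\<^sup>2 * (cosh (u t))\<^sup>2 - (u1 t)\<^sup>2)" if "t \<in> {a..b}" for t
    using Q[OF that] by (simp_all add: w_eq[OF that])
  have equation_iff: "(geodesic_curvature \<epsilon> a b (Psi_curve u v) t =
       - ((ivl_deriv a b u t * cos (v t)
            + ivl_deriv a b v t * sinh (u t) * cosh (u t) * sin (v t))
          / ((cosh (u t) * sin (v t) + l) * lspeed \<epsilon> a b (Psi_curve u v) t)))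
      \<longleftrightarrow> curvature_defect \<epsilon> l a b u v t = 0" if "t \<in> {a..b}" for t
  proof -
    \<comment> \<open>Clearing denominators is legitimate because the factor
      \<open>cosh (u t) * sin (v t) + l\<close> is nonzero and the speed is positive.\<close>
    have "k = - (X / (F * W)) \<longleftrightarrow> F * k * W + X = 0" if "F \<noteq> 0" "W > 0" for k X F W :: real
      using that by (auto simp: field_simps)
    then show ?thesis
      unfolding curvature_defect_def using assms(6)[OF that] w(1)[OF that]
      by (simp add: w_def)
  qed
  have "catenary_xz \<epsilon> l a b u v \<longleftrightarrow> (\<forall>t\<in>{a..b}. curvature_defect \<epsilon> l a b u v t = 0)"
  proof
    assume zero: "\<forall>t\<in>{a..b}. curvature_defect \<epsilon> l a b u v t = 0"
    show "catenary_xz \<epsilon> l a b u v"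
      unfolding catenary_xz_def
    proof (intro conjI allI impI adm)
      fix \<delta> U V
      assume "variation \<epsilon> a b u v \<delta> U V"
      then show "((\<lambda>s. energy_xz \<epsilon> l a b (U s) (V s)) has_real_derivative 0) (at 0)"
        by (rule DERIV_cong[OF first_variation[OF ab]])
          (intro integral_unique has_integral_is_0, simp add: zero)
    qed
  next
    assume cat: "catenary_xz \<epsilon> l a b u v"
    \<comment> \<open>The defect times \<open>w\<^sup>2\<close>, which has no denominators and is therefore visibly smooth.\<close>
    define N where "N = (\<lambda>t. (cosh (u t) * sin (v t) + l) *
        (\<epsilon> * (v1 t * (u2 t + v1 t * v1 t * cosh (u t) * sinh (u t)) * cosh (u t)
          + (-1) * (u1 t * (v2 t * cosh (u t) + 2 * u1 t * v1 t * sinh (u t)))))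
      + (u1 t * cos (v t) + v1 t * sinh (u t) * cosh (u t) * sin (v t)) *
        (\<epsilon> * (v1 t * v1 t * (cosh (u t) * cosh (u t)) + (-1) * (u1 t * u1 t))))"
    have defect: "curvature_defect \<epsilon> l a b u v t = N t / (w t)\<^sup>2" if "t \<in> {a..b}" for t
    proof -
      have "N t = (cosh (u t) * sin (v t) + l) *
        (\<epsilon> * (v1 t * (u2 t + (v1 t)\<^sup>2 * cosh (u t) * sinh (u t)) * cosh (u t)
          - u1 t * (v2 t * cosh (u t) + 2 * u1 t * v1 t * sinh (u t))))
        + (u1 t * cos (v t) + v1 t * sinh (u t) * cosh (u t) * sin (v t)) * (w t)\<^sup>2"
        unfolding N_def w(2)[OF that] by (simp add: power2_eq_square)
      moreover have "geodesic_curvature \<epsilon> a b (Psi_curve u v) t =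
          \<epsilon> * (v1 t * (u2 t + (v1 t)\<^sup>2 * cosh (u t) * sinh (u t)) * cosh (u t)
          - u1 t * (v2 t * cosh (u t) + 2 * u1 t * v1 t * sinh (u t))) / w t ^ 3"
        unfolding w_def by (rule geodesic_curvature_Psi_curve[OF ab du dv that du1[OF that] dv1[OF that]])
      moreover have "F * (\<epsilon> * K / W ^ 3) * W + X = (F * (\<epsilon> * K) + X * W\<^sup>2) / W\<^sup>2" if "W > 0"
        for F K X W :: real
        using that by (simp add: field_simps power2_eq_square power3_eq_cube)
      ultimately show ?thesis
        using w(1)[OF that]
        by (simp only: curvature_defect_def w_def[symmetric] u1_def[symmetric] v1_def[symmetric])
    qed
    have N: "smooth_expr a b N"
      unfolding N_def
      by (intro smooth_expr.add smooth_expr.mult smooth_expr.const smooth_expr.sin smooth_expr.cos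
          smooth_expr.sinh smooth_expr.cosh smooth_expr.base u v smooth)
    \<comment> \<open>Vanishes at the endpoints and is positive between them; differences are
      spelled as sums and products to match the rules of \<open>smooth_expr\<close>.\<close>
    define \<phi> where "\<phi> = (\<lambda>t. (t + (-a)) * (b + (-1) * t))"
    have \<phi>: "smooth_expr a b \<phi>"
      unfolding \<phi>_def
      by (intro smooth_expr.add smooth_expr.mult smooth_expr.const smooth_expr.ident)
    \<comment> \<open>As \<open>N\<close> is the defect times \<open>w\<^sup>2\<close>, this is the
      field announced at the outset. The opposite signs of the two components make their
      contributions add up to a multiple of u'^2 + v'^2, and the factor \<epsilon> cancels the one
      in the first variation.\<close>
    define \<eta> where "\<eta> = (\<lambda>t. \<phi> t * (\<epsilon> * (N t * v1 t)))"
    define \<zeta> where "\<zeta> = (\<lambda>t. \<phi> t * ((-\<epsilon>) * (N t * u1 t)))"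
    have sm: "smooth_ivl a b \<eta>" "smooth_ivl a b \<zeta>"
      unfolding \<eta>_def \<zeta>_def
      by (intro smooth_expr_imp_smooth_ivl[OF ab] smooth_expr.mult smooth_expr.const
          smooth_expr.base[OF smooth(1)] smooth_expr.base[OF smooth(2)] N \<phi>)+
    have ends: "\<eta> a = 0" "\<eta> b = 0" "\<zeta> a = 0" "\<zeta> b = 0"
      by (simp_all add: \<eta>_def \<zeta>_def \<phi>_def)
    obtain \<delta> where
      var: "variation \<epsilon> a b u v \<delta> (\<lambda>s t. u t + s * \<eta> t) (\<lambda>s t. v t + s * \<zeta> t)"
      by (rule variation_exists[OF ab adm sm(1) ends(1,2) sm(2) ends(3,4)])
    \<comment> \<open>The speed appears as an explicit root, with which \<open>w\<close> agrees only
      on the interval, so that continuity follows factor by factor. The cube combines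
      \<open>w\<^sup>2\<close> from the defect with \<open>w\<close> from the variation
      formula.\<close>
    define g where "g = (\<lambda>t. cosh (u t) * \<phi> t * (N t)\<^sup>2 * ((u1 t)\<^sup>2 + (v1 t)\<^sup>2)
        / sqrt (\<epsilon> * ((v1 t)\<^sup>2 * (cosh (u t))\<^sup>2 - (u1 t)\<^sup>2)) ^ 3)"
    have deriv: "deriv (\<lambda>s. x + s * y) 0 = y" for x y :: real
      by (rule DERIV_imp_deriv) (auto intro!: derivative_eq_intros)
    have integrand: "\<epsilon> * cosh (u t) * curvature_defect \<epsilon> l a b u v t / lspeed \<epsilon> a b (Psi_curve u v) t
        * (ivl_deriv a b v t * deriv (\<lambda>s. u t + s * \<eta> t) 0
          - ivl_deriv a b u t * deriv (\<lambda>s. v t + s * \<zeta> t) 0) = g t" if "t \<in> {a..b}" for t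
    proof -
      have "\<epsilon> * C * (n / W\<^sup>2) / W * (y * (f * (\<epsilon> * (n * y))) - x * (f * (- \<epsilon> * (n * x)))) =
          (\<epsilon> * \<epsilon>) * (C * f * n\<^sup>2 * (x\<^sup>2 + y\<^sup>2)) / W ^ 3" if "W > 0" for C n W x y f :: real
        using that by (simp add: field_simps power2_eq_square power3_eq_cube)
      from this[OF w(1)[OF that]]
      have "\<epsilon> * cosh (u t) * (N t / (w t)\<^sup>2) / w t * (v1 t * \<eta> t - u1 t * \<zeta> t) =
          (\<epsilon> * \<epsilon>) * (cosh (u t) * \<phi> t * (N t)\<^sup>2 * ((u1 t)\<^sup>2 + (v1 t)\<^sup>2)) / w t ^ 3"
        unfolding \<eta>_def \<zeta>_def .
      then show ?thesis
        unfolding g_def \<epsilon> deriv defect[OF that] w_def[symmetric] w_eq[OF that, symmetric]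
          u1_def[symmetric] v1_def[symmetric] by simp
    qed
    have "((\<lambda>s. energy_xz \<epsilon> l a b (\<lambda>t. u t + s * \<eta> t) (\<lambda>t. v t + s * \<zeta> t))
        has_real_derivative integral {a..b} g) (at 0)"
      by (rule DERIV_cong[OF first_variation[OF ab var]]) (intro integral_cong integrand)
    moreover have "((\<lambda>s. energy_xz \<epsilon> l a b (\<lambda>t. u t + s * \<eta> t) (\<lambda>t. v t + s * \<zeta> t))
        has_real_derivative 0) (at 0)"
      using cat var unfolding catenary_xz_def by blast
    ultimately have "integral {a..b} g = 0"
      by (rule DERIV_unique)
    moreover have cont: "continuous_on {a..b} N" "continuous_on {a..b} \<phi>"
      using N \<phi> by (auto intro: smooth_ivl_imp_continuous_on smooth_expr_imp_smooth_ivl ab)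
    moreover have "sqrt (\<epsilon> * ((v1 t)\<^sup>2 * (cosh (u t))\<^sup>2 - (u1 t)\<^sup>2)) ^ 3 \<noteq> 0" if "t \<in> {a..b}" for t
      unfolding w_eq[OF that, symmetric] using w(1)[OF that] by simp
    then have "continuous_on {a..b} g"
      unfolding g_def
      by (intro continuous_intros ballI cont smooth_ivl_imp_continuous_on[OF ab u]
          smooth_ivl_imp_continuous_on[OF ab smooth(1)] smooth_ivl_imp_continuous_on[OF ab smooth(2)])
    moreover have "g t \<ge> 0" if "t \<in> {a..b}" for t
      unfolding g_def using that Q[OF that]
      by (intro divide_nonneg_nonneg mult_nonneg_nonneg) (auto simp: \<phi>_def)
    \<comment> \<open>A continuous nonnegative function with zero integral vanishes
      identically.\<close>
    ultimately have g0: "g t = 0" if "t \<in> {a..b}" for t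
      using integral_eq_0_iff[of a b g] ab that by auto
    \<comment> \<open>At the endpoints \<open>\<phi>\<close> is 0 and \<open>g\<close> carries no
      information, so the interior comes first. There every other factor is nonzero: u' = v' = 0
      would make the squared speed vanish.\<close>
    have "N t = 0" if "t \<in> {a<..<b}" for t
    proof -
      from that have t: "t \<in> {a..b}" by auto
      have "\<phi> t > 0" using that by (simp add: \<phi>_def)
      moreover have "(u1 t)\<^sup>2 + (v1 t)\<^sup>2 \<noteq> 0"
        using Q[OF t] by (auto simp: sum_power2_eq_zero_iff)
      moreover have "cosh (u t) > 0" by simp
      ultimately show ?thesis
        using g0[OF t] w(1)[OF t] unfolding g_def w_eq[OF t, symmetric] by auto
    qed
    \<comment> \<open>Continuity extends the vanishing to the closure of the open interval.\<close>
    then have "N t = 0" if "t \<in> {a..b}" for t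
      using continuous_constant_on_closure[of "{a<..<b}" N 0 t] cont(1) that ab
      by (simp add: closure_greaterThanLessThan)
    then show "\<forall>t\<in>{a..b}. curvature_defect \<epsilon> l a b u v t = 0"
      by (simp add: defect)
  qed
  then show ?thesis using equation_iff by simp
qed

end
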